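(* There is an absolute constant $c>0$ such that the following holds. Let $f:[n]^d\to\{0,1\}$ be $\varepsilon$-far from being monotone. Let $r$ be the minimum, over all maximal matchings $M$ in the violation graph of $f$, of the average distance $\frac{1}{|M|}\sum_{(x,y)\in M} d_{\mathbf{A}}(x,y)$. Then $\Gamma^-_f\ge c\,\varepsilon/r$.
   Context: $[n]^d$ is partially ordered coordinatewise ($x\prec y$ iff $x\preceq y$ and $x\neq y$); $f$ is monotone if $f(x)\le f(y)$ whenever $x\preceq y$, and $\varepsilon$-far from monotone if it differs from every monotone function on at least $\varepsilon n^d$ points. The violation graph of $f$ has an edge $(x,y)$ whenever $x\prec y$, $f(x)=1$, $f(y)=0$; a matching is a set of vertex-disjoint such pairs, maximal with respect to inclusion. The augmented hypergrid $\mathbf{A}_{n,d}$ is the directed graph on $[n]^d$ with an edge $(x,y)$ whenever $x,y$ differ in exactly one coordinate $i$ and $y_i-x_i=2^a$ for some integer $a\ge0$; $d_{\mathbf{A}}$ is its directed shortest-path distance. $S^-_f$ is the set of edges $(x,y)$ of $\mathbf{A}_{n,d}$ with $f(x)=1,f(y)=0$, and $\Gamma^-_f:=\frac{1}{n^d}\cdot$ (size of a maximum-cardinality matching contained in $S^-_f$). *)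

theory Defs
  imports Complex_Main "HOL-Library.FuncSet"
begin

text \<open>The grid \<open>[n]^d\<close> consists of the extensional functions from \<open>{1..d}\<close> to \<open>{1..n}\<close>.
  They all agree outside \<open>{1..d}\<close>, so the pointwise order on functions restricted to the grid
  is the coordinatewise order, with \<open><\<close> as its strict part.\<close>

type_synonym point = "nat \<Rightarrow> nat"

definition hypergrid :: "nat \<Rightarrow> nat \<Rightarrow> point set" where
  "hypergrid n d = ({1..d} \<rightarrow>\<^sub>E {1..n})"

definition far_from_monotone :: "nat \<Rightarrow> nat \<Rightarrow> real \<Rightarrow> (point \<Rightarrow> nat) \<Rightarrow> bool" where
  "far_from_monotone n d \<epsilon> f \<longleftrightarrow>
     (\<forall>g \<in> hypergrid n d \<rightarrow> {0, 1}. mono_on (hypergrid n d) g \<longrightarrow>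
        real (card {x \<in> hypergrid n d. f x \<noteq> g x}) \<ge> \<epsilon> * real n ^ d)"

definition is_matching :: "('a \<times> 'a) set \<Rightarrow> ('a \<times> 'a) set \<Rightarrow> bool" where
  "is_matching E M \<longleftrightarrow>
     M \<subseteq> E \<and> pairwise (\<lambda>(x, y) (x', y'). disjnt {x, y} {x', y'}) M"

definition is_maximal_matching :: "('a \<times> 'a) set \<Rightarrow> ('a \<times> 'a) set \<Rightarrow> bool" where
  "is_maximal_matching E M \<longleftrightarrow> is_matching E M \<and> \<not> (\<exists>M'. is_matching E M' \<and> M \<subset> M')"

definition violation_graph :: "nat \<Rightarrow> nat \<Rightarrow> (point \<Rightarrow> nat) \<Rightarrow> (point \<times> point) set" where
  "violation_graph n d f =
     {(x, y). x \<in> hypergrid n d \<and> y \<in> hypergrid n d \<and> x < y \<and> f x = 1 \<and> f y = 0}"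

definition augmented_hypergrid :: "nat \<Rightarrow> nat \<Rightarrow> (point \<times> point) set" where
  "augmented_hypergrid n d =
     {(x, y). x \<in> hypergrid n d \<and> y \<in> hypergrid n d \<and>
        (\<exists>i \<in> {1..d}. {j \<in> {1..d}. x j \<noteq> y j} = {i} \<and> (\<exists>a. y i = x i + 2 ^ a))}"

text \<open>The directed distance is the least length of a directed walk from \<open>x\<close> to \<open>y\<close>.  It is
  unspecified if there is no such walk; \<open>augmented_hypergrid_connected\<close> below shows
  that this does not happen for comparable points, hence not for edges of the violation graph.\<close>

definition augmented_dist :: "nat \<Rightarrow> nat \<Rightarrow> point \<Rightarrow> point \<Rightarrow> nat" where
  "augmented_dist n d x y = (LEAST k. (x, y) \<in> augmented_hypergrid n d ^^ k)"

definition average_dist :: "nat \<Rightarrow> nat \<Rightarrow> (point \<times> point) set \<Rightarrow> real" where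
  "average_dist n d M = (\<Sum>(x, y)\<in>M. real (augmented_dist n d x y)) / real (card M)"

definition min_average_dist :: "nat \<Rightarrow> nat \<Rightarrow> (point \<Rightarrow> nat) \<Rightarrow> real" where
  "min_average_dist n d f =
     Min (average_dist n d ` {M. is_maximal_matching (violation_graph n d f) M})"

definition violating_edges :: "nat \<Rightarrow> nat \<Rightarrow> (point \<Rightarrow> nat) \<Rightarrow> (point \<times> point) set" where
  "violating_edges n d f = {(x, y) \<in> augmented_hypergrid n d. f x = 1 \<and> f y = 0}"

definition Gamma_minus :: "nat \<Rightarrow> nat \<Rightarrow> (point \<Rightarrow> nat) \<Rightarrow> real" where
  "Gamma_minus n d f =
     real (Max (card ` {M. is_matching (violating_edges n d f) M})) / real n ^ d"

lemma augmented_hypergrid_connected: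
  assumes "x \<in> hypergrid n d" "y \<in> hypergrid n d" "x \<le> y"
  shows "\<exists>k. (x, y) \<in> augmented_hypergrid n d ^^ k"
  using assms
proof (induction "\<Sum>i=1..d. y i - x i" arbitrary: x rule: less_induct)
  case less
  show ?case
  proof (cases "x = y")
    case True
    then show ?thesis by (intro exI[of _ 0]) simp
  next
    case False
    have out: "x j = y j" if "j \<notin> {1..d}" for j
      using less.prems that unfolding hypergrid_def PiE_def extensional_def by auto
    from False obtain i where i: "x i \<noteq> y i" by auto
    then have id: "i \<in> {1..d}" using out by blast
    have lt: "x i < y i" using i less.prems(3) by (simp add: le_fun_def le_neq_implies_less)
    define z where "z = x(i := x i + 1)"
    have zg: "z \<in> hypergrid n d"
    proof -
      have "y i \<le> n" using less.prems(2) id by (auto simp: hypergrid_def PiE_iff)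
      then show ?thesis using less.prems(1) lt id
        by (auto simp: z_def hypergrid_def PiE_iff extensional_def)
    qed
    have zy: "z \<le> y" using less.prems(3) lt by (auto simp: z_def le_fun_def)
    have "(\<Sum>j=1..d. y j - z j) < (\<Sum>j=1..d. y j - x j)"
      by (rule sum_strict_mono_ex1) (use id lt in \<open>auto simp: z_def intro!: bexI[of _ i]\<close>)
    from less.hyps[OF this zg less.prems(2) zy] obtain k
      where k: "(z, y) \<in> augmented_hypergrid n d ^^ k" by blast
    have "{j \<in> {1..d}. x j \<noteq> z j} = {i}" using id by (auto simp: z_def)
    moreover have "z i = x i + 2 ^ 0" by (simp add: z_def)
    ultimately have "(x, z) \<in> augmented_hypergrid n d"
      using less.prems(1) zg id unfolding augmented_hypergrid_def by blast
    then show ?thesis using k relpow_Suc_I2 by metis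
  qed
qed

lemma finite_violation_graph: "finite (violation_graph n d f)"
proof (rule finite_subset)
  show "violation_graph n d f \<subseteq> hypergrid n d \<times> hypergrid n d"
    by (auto simp: violation_graph_def)
  show "finite (hypergrid n d \<times> hypergrid n d)"
    by (simp add: hypergrid_def finite_PiE)
qed

lemma finite_violating_edges: "finite (violating_edges n d f)"
proof (rule finite_subset)
  show "violating_edges n d f \<subseteq> hypergrid n d \<times> hypergrid n d"
    by (auto simp: violating_edges_def augmented_hypergrid_def)
  show "finite (hypergrid n d \<times> hypergrid n d)"
    by (simp add: hypergrid_def finite_PiE)
qed

text \<open>The sets over which \<^const>\<open>Min\<close> and \<^const>\<open>Max\<close> are taken above are finite and nonempty.\<close>

lemma finite_matchings: "finite E \<Longrightarrow> finite {M. is_matching E M}"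
  by (rule finite_subset[of _ "Pow E"]) (auto simp: is_matching_def)

lemma is_matching_empty: "is_matching E {}"
  by (simp add: is_matching_def)

lemma finite_maximal_matchings: "finite E \<Longrightarrow> finite {M. is_maximal_matching E M}"
  by (rule finite_subset[OF _ finite_matchings]) (auto simp: is_maximal_matching_def)

lemma maximal_matching_exists:
  assumes "finite E"
  shows "\<exists>M. is_maximal_matching E M"
  using finite_has_maximal[OF finite_matchings[OF assms]] is_matching_empty[of E]
  unfolding is_maximal_matching_def by (metis empty_iff mem_Collect_eq psubsetE subset_refl)

end

theory Submission
  imports Defs
begin

text \<open>Write \<open>V\<close> for the violation graph.  Let \<open>M\<close> be a maximal matching in \<open>V\<close> with average
  distance \<open>r\<close>.  Its endpoints cover all violations, so \<open>2 |M| \<ge> \<epsilon> n^d\<close>, and at least half of its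
  pairs have distance at most \<open>2r\<close>.  Now match greedily by increasing distance up to \<open>2r\<close>.  The
  result \<open>N\<close> is maximal among the pairs of distance at most \<open>2r\<close>, hence \<open>4 |N| \<ge> |M|\<close>, and in the
  class of pairs of distance \<open>l\<close> no lower endpoint is closer than \<open>l\<close> to any upper endpoint.

  Such a class of size \<open>m\<close> is joined by \<open>m\<close> vertex-disjoint walks of length \<open>l\<close>: arrange the
  vertices on these walks in layers by the distance from the lower endpoints.  In-degrees increase
  and out-degrees decrease strictly along the edges between the layers, which excludes a bottleneck.
  As each walk contains a violating edge, \<open>m \<le> \<Gamma> n^d\<close>.  There are at most \<open>2r\<close> classes, so
  \<open>|N| \<le> 2r \<Gamma> n^d\<close>.\<close>

section \<open>Hall's theorem\<close>

text \<open>Halmos-Vaughan induction: either a nonempty proper \<open>J\<close> is tight and the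
  problem splits into \<open>J\<close> and the rest, or all such \<open>J\<close> have a spare
  neighbour and one element may be matched arbitrarily.\<close>

theorem hall:
  fixes A :: "'a \<Rightarrow> 'b set"
  assumes "finite I" "\<And>i. i \<in> I \<Longrightarrow> finite (A i)"
    and "\<And>J. J \<subseteq> I \<Longrightarrow> card J \<le> card (\<Union>i\<in>J. A i)"
  shows "\<exists>h. inj_on h I \<and> (\<forall>i\<in>I. h i \<in> A i)"
  using assms
proof (induction "card I" arbitrary: I A rule: less_induct)
  case less
  note finI = less.prems(1) and finA = less.prems(2) and hall = less.prems(3)
  show ?case
  proof (cases "\<exists>J. J \<subset> I \<and> J \<noteq> {} \<and> card (\<Union>i\<in>J. A i) = card J")
    case True
    then obtain J where J: "J \<subset> I" "J \<noteq> {}" "card (\<Union>i\<in>J. A i) = card J" by blast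
    have finJ: "finite J" using J(1) finI finite_subset by blast
    have "card J < card I" using J(1) finI psubset_card_mono by blast
    then have "\<exists>h. inj_on h J \<and> (\<forall>i\<in>J. h i \<in> A i)"
      using J(1) finJ finA hall by (intro less.hyps) (auto simp: subset_eq psubset_eq)
    then obtain h where h: "inj_on h J" "\<forall>i\<in>J. h i \<in> A i" by blast
    define U where "U = (\<Union>i\<in>J. A i)"
    have finU: "finite U" using finJ finA J(1) by (auto simp: U_def)
    have "\<exists>h. inj_on h (I - J) \<and> (\<forall>i\<in>I - J. h i \<in> A i - U)"
    proof (rule less.hyps)
      show "card (I - J) < card I"
        using J(1,2) finI by (intro psubset_card_mono) auto
    next
      fix K assume K: "K \<subseteq> I - J"
      have finK: "finite K" using K finI finite_subset by blast
      \<comment> \<open>Outside the tight set Hall's condition survives: apply it to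
        \<open>K \<union> J\<close> and cancel \<open>card J = card U\<close>.\<close>
      have "card K + card J = card (K \<union> J)"
        using K finK finJ by (intro card_Un_disjoint[symmetric]) auto
      also have "\<dots> \<le> card (\<Union>i\<in>K \<union> J. A i)"
        using K J(1) by (intro hall) auto
      also have "(\<Union>i\<in>K \<union> J. A i) = (\<Union>i\<in>K. A i - U) \<union> U"
        by (auto simp: U_def)
      also have "card \<dots> \<le> card (\<Union>i\<in>K. A i - U) + card U"
        by (rule card_Un_le)
      finally show "card K \<le> card (\<Union>i\<in>K. A i - U)" using J(3) by (simp add: U_def)
    qed (use finI finA in auto)
    then obtain h' where h': "inj_on h' (I - J)" "\<forall>i\<in>I - J. h' i \<in> A i - U" by blast
    define g where "g = (\<lambda>i. if i \<in> J then h i else h' i)"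
    have "inj_on (\<lambda>i. if i \<in> J then h i else h' i) (J \<union> (I - J))"
      by (rule inj_on_disjoint_Un[OF h(1) h'(1)]) (use h(2) h'(2) in \<open>auto simp: U_def\<close>)
    then have "inj_on g I" using J(1) by (simp add: g_def Un_absorb1 psubset_imp_subset)
    moreover have "\<forall>i\<in>I. g i \<in> A i" using h h' by (auto simp: g_def)
    ultimately show ?thesis by blast
  next
    case no_tight: False
    show ?thesis
    proof (cases "I = {}")
      case True
      then show ?thesis by simp
    next
      case False
      then obtain i where i: "i \<in> I" by blast
      have "card {i} \<le> card (\<Union>j\<in>{i}. A j)" using i by (intro hall) auto
      then have "A i \<noteq> {}" by auto
      then obtain b where b: "b \<in> A i" by blast
      \<comment> \<open>Deleting the single value \<open>b\<close> costs at most the spare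
        neighbour.\<close>
      have "\<exists>h. inj_on h (I - {i}) \<and> (\<forall>j\<in>I - {i}. h j \<in> A j - {b})"
      proof (rule less.hyps)
        show "card (I - {i}) < card I" using i finI by (rule card_Diff1_less[rotated])
      next
        fix K assume K: "K \<subseteq> I - {i}"
        show "card K \<le> card (\<Union>j\<in>K. A j - {b})"
        proof (cases "K = {}")
          case False
          have "card (\<Union>j\<in>K. A j) \<noteq> card K"
            using no_tight K False i by blast
          moreover have "card K \<le> card (\<Union>j\<in>K. A j)" using K by (intro hall) auto
          ultimately have "card K \<le> card (\<Union>j\<in>K. A j) - 1" by simp
          also have "\<dots> \<le> card ((\<Union>j\<in>K. A j) - {b})" using diff_card_le_card_Diff[of "{b}" "\<Union>j\<in>K. A j"] by simp
          also have "(\<Union>j\<in>K. A j) - {b} = (\<Union>j\<in>K. A j - {b})" by auto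
          finally show ?thesis .
        qed simp
      qed (use finI finA in auto)
      then obtain h where h: "inj_on h (I - {i})" "\<forall>j\<in>I - {i}. h j \<in> A j - {b}" by blast
      have "inj_on (h(i := b)) I"
        using h by (auto simp: inj_on_def)
      moreover have "\<forall>j\<in>I. (h(i := b)) j \<in> A j" using h b by auto
      ultimately show ?thesis by blast
    qed
  qed
qed

section \<open>Vertex-disjoint walks\<close>

text \<open>This expresses distance at least \<open>l\<close> without a distance function;
  unreachable pairs satisfy it vacuously.\<close>

definition far_apart :: "'a rel \<Rightarrow> 'a set \<Rightarrow> 'a set \<Rightarrow> nat \<Rightarrow> bool" where
  "far_apart E S T l \<longleftrightarrow> (\<forall>x\<in>S. \<forall>y\<in>T. \<forall>k. (x, y) \<in> E ^^ k \<longrightarrow> l \<le> k)"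

text \<open>The points \<open>x\<close> and \<open>y\<close> range independently over
  \<open>S\<close> and \<open>T\<close>; they need not be partners in any pairing.\<close>

definition layer :: "'a rel \<Rightarrow> 'a set \<Rightarrow> 'a set \<Rightarrow> nat \<Rightarrow> nat \<Rightarrow> 'a set" where
  "layer E S T l i = {z. \<exists>x\<in>S. \<exists>y\<in>T. (x, z) \<in> E ^^ i \<and> (z, y) \<in> E ^^ (l - i)}"

text \<open>The exemption for \<open>(u, z') \<in> E\<close> admits two equal steps in one
  coordinate, which cannot be reordered but merge into one edge. Between layers of far apart sets
  such shortcuts do not occur.\<close>

definition completes_squares :: "'a rel \<Rightarrow> bool" where
  "completes_squares E \<longleftrightarrow> (\<forall>z z'. (z, z') \<in> E \<longrightarrow>
     (\<exists>g. inj_on g {u. (u, z) \<in> E} \<and>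
          (\<forall>u. (u, z) \<in> E \<and> (u, z') \<notin> E \<longrightarrow> (u, g u) \<in> E \<and> (g u, z') \<in> E \<and> g u \<noteq> z)))"

lemma converse_relpow:
  fixes E :: "'a rel"
  shows "(E\<inverse>) ^^ k = (E ^^ k)\<inverse>"
  proof (induction k)
  case (Suc k)
  have "(E\<inverse>) ^^ Suc k = (E ^^ k)\<inverse> O E\<inverse>" by (simp add: Suc)
  also have "\<dots> = (E O E ^^ k)\<inverse>" by (simp add: converse_relcomp)
  finally show ?case by (simp add: relpow_commute)
qed simp

lemma far_apart_converse: "far_apart E S T l \<Longrightarrow> far_apart (E\<inverse>) T S l"
  by (auto simp: far_apart_def converse_relpow)

lemma layer_converse: "i \<le> l \<Longrightarrow> layer (E\<inverse>) T S l (l - i) = layer E S T l i"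
  by (auto simp: layer_def converse_relpow)

lemma finite_layer_Suc:
  assumes "finite E"
  shows "finite (layer E S T l (Suc i))"
proof (rule finite_subset)
  show "layer E S T l (Suc i) \<subseteq> Range E" by (auto simp: layer_def)
qed (use assms in \<open>simp add: finite_Range\<close>)

lemma card_edges_by_target:
  assumes "finite E" "finite B"
  shows "card (E \<inter> A \<times> B) = (\<Sum>b\<in>B. card {a\<in>A. (a, b) \<in> E})"
proof -
  have fin: "finite {a\<in>A. (a, b) \<in> E}" for b
    by (rule finite_subset[of _ "Domain E"]) (use assms(1) finite_Domain in auto)
  have "card (E \<inter> A \<times> B) = card (SIGMA b:B. {a\<in>A. (a, b) \<in> E})"
    by (rule bij_betw_same_card[of prod.swap], rule bij_betw_byWitness[of _ prod.swap]) auto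
  then show ?thesis using assms(2) fin by simp
qed

text \<open>Along an edge between consecutive layers the in-degree grows by at least one: the incoming
  edges are completed to squares, and the edge itself is a further incoming edge.\<close>

lemma edges_grow_forward:
  assumes E: "finite E" "completes_squares E" and far: "far_apart E S T l" and l: "Suc (Suc i) \<le> l"
    and s: "inj_on s (layer E S T l (Suc i))"
    and s_layer: "\<And>b. b \<in> layer E S T l (Suc i) \<Longrightarrow> s b \<in> layer E S T l (Suc (Suc i)) \<and> (b, s b) \<in> E"
  shows "card (E \<inter> layer E S T l i \<times> layer E S T l (Suc i)) + card (layer E S T l (Suc i))
    \<le> card (E \<inter> layer E S T l (Suc i) \<times> layer E S T l (Suc (Suc i)))"
proof -
  let ?A = "layer E S T l i" and ?B = "layer E S T l (Suc i)" and ?C = "layer E S T l (Suc (Suc i))"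
  have fin: "finite ?B" "finite ?C" by (rule finite_layer_Suc[OF E(1)])+
  have deg: "card {a\<in>?A. (a, b) \<in> E} + 1 \<le> card {b'\<in>?B. (b', s b) \<in> E}" if b: "b \<in> ?B" for b
  proof -
    from s_layer[OF b] obtain y where y: "y \<in> T" "(s b, y) \<in> E ^^ (l - Suc (Suc i))"
      and e: "(b, s b) \<in> E" by (auto simp: layer_def)
    from E(2) e obtain g where g: "inj_on g {u. (u, b) \<in> E}"
      "\<And>u. (u, b) \<in> E \<Longrightarrow> (u, s b) \<notin> E \<Longrightarrow> (u, g u) \<in> E \<and> (g u, s b) \<in> E \<and> g u \<noteq> b"
      unfolding completes_squares_def by meson
    have *: "g a \<in> ?B \<and> (g a, s b) \<in> E \<and> g a \<noteq> b" if a: "a \<in> ?A" "(a, b) \<in> E" for a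
    proof -
      from a(1) obtain x where x: "x \<in> S" "(x, a) \<in> E ^^ i" by (auto simp: layer_def)
      \<comment> \<open>A shortcut would give a walk of length \<open>l - 1\<close> from
        \<open>x\<close> to \<open>y\<close>.\<close>
      have "(a, s b) \<notin> E"
      proof
        assume "(a, s b) \<in> E"
        then have "(x, y) \<in> E ^^ (Suc i + (l - Suc (Suc i)))"
          using x(2) y(2) relpow_Suc_I relpow_trans by metis
        then have "l \<le> Suc i + (l - Suc (Suc i))"
          using far x(1) y(1) by (auto simp: far_apart_def)
        then show False using l by simp
      qed
      from g(2)[OF a(2) this] have ga: "(a, g a) \<in> E" "(g a, s b) \<in> E" "g a \<noteq> b" by auto
      have "(g a, y) \<in> E ^^ (l - Suc i)"
        using relpow_Suc_I2[OF ga(2) y(2)] l by (simp add: Suc_diff_Suc Suc_le_lessD)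
      moreover have "(x, g a) \<in> E ^^ Suc i" using x(2) ga(1) by (rule relpow_Suc_I)
      ultimately show ?thesis using ga x(1) y(1) unfolding layer_def by blast
    qed
    have finA: "finite {a\<in>?A. (a, b) \<in> E}"
      by (rule finite_subset[of _ "Domain E"]) (use E(1) finite_Domain in auto)
    have "card {a\<in>?A. (a, b) \<in> E} + 1 = card (insert b (g ` {a\<in>?A. (a, b) \<in> E}))"
    proof -
      have "card (g ` {a\<in>?A. (a, b) \<in> E}) = card {a\<in>?A. (a, b) \<in> E}"
        by (rule card_image) (use g(1) in \<open>auto simp: inj_on_def\<close>)
      moreover have "b \<notin> g ` {a\<in>?A. (a, b) \<in> E}" using * by auto
      ultimately show ?thesis using finA by simp
    qed
    also have "\<dots> \<le> card {b'\<in>?B. (b', s b) \<in> E}"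
      by (rule card_mono) (use fin * b e in auto)
    finally show ?thesis .
  qed
  have "card (E \<inter> ?A \<times> ?B) + card ?B = (\<Sum>b\<in>?B. card {a\<in>?A. (a, b) \<in> E} + 1)"
    unfolding card_edges_by_target[OF E(1) fin(1)] by (simp only: sum.distrib card_eq_sum)
  also have "\<dots> \<le> (\<Sum>b\<in>?B. card {b'\<in>?B. (b', s b) \<in> E})"
    by (intro sum_mono deg)
  also have "\<dots> = (\<Sum>c\<in>s ` ?B. card {b'\<in>?B. (b', c) \<in> E})"
    by (simp add: sum.reindex[OF s])
  also have "\<dots> \<le> (\<Sum>c\<in>?C. card {b'\<in>?B. (b', c) \<in> E})"
    by (rule sum_mono2) (use fin s_layer in auto)
  also have "\<dots> = card (E \<inter> ?B \<times> ?C)"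
    using card_edges_by_target[OF E(1) fin(2)] by simp
  finally show ?thesis .
qed

text \<open>Reversing the edges exchanges \<open>S\<close> with \<open>T\<close> and in-degrees with
  out-degrees, so the forward inequality applies to \<open>E\<inverse>\<close>.\<close>

lemma edges_grow_backward:
  assumes E: "finite E" "completes_squares (E\<inverse>)" and far: "far_apart E S T l" and l: "Suc (Suc i) \<le> l"
    and p: "inj_on p (layer E S T l (Suc i))"
    and p_layer: "\<And>b. b \<in> layer E S T l (Suc i) \<Longrightarrow> p b \<in> layer E S T l i \<and> (p b, b) \<in> E"
  shows "card (E \<inter> layer E S T l (Suc i) \<times> layer E S T l (Suc (Suc i))) + card (layer E S T l (Suc i))
    \<le> card (E \<inter> layer E S T l i \<times> layer E S T l (Suc i))"
proof -
  \<comment> \<open>Layer \<open>i\<close> of \<open>E\<close> is layer \<open>l - i\<close> of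
    \<open>E\<inverse>\<close>; thus \<open>j\<close>, \<open>j + 1\<close>, \<open>j + 2\<close>
    name the layers \<open>i + 2\<close>, \<open>i + 1\<close>, \<open>i\<close>.\<close>
  define j where "j = l - Suc (Suc i)"
  have lay: "layer (E\<inverse>) T S l j = layer E S T l (Suc (Suc i))"
    "layer (E\<inverse>) T S l (Suc j) = layer E S T l (Suc i)"
    "layer (E\<inverse>) T S l (Suc (Suc j)) = layer E S T l i"
    using layer_converse[of "Suc (Suc i)" l E T S] layer_converse[of "Suc i" l E T S]
      layer_converse[of i l E T S] l by (simp_all add: j_def Suc_diff_Suc Suc_le_lessD)
  have conv: "card (E\<inverse> \<inter> A \<times> B) = card (E \<inter> B \<times> A)" for A B
    by (rule bij_betw_same_card[of prod.swap], rule bij_betw_byWitness[of _ prod.swap]) auto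
  have "card (E\<inverse> \<inter> layer (E\<inverse>) T S l j \<times> layer (E\<inverse>) T S l (Suc j)) + card (layer (E\<inverse>) T S l (Suc j))
    \<le> card (E\<inverse> \<inter> layer (E\<inverse>) T S l (Suc j) \<times> layer (E\<inverse>) T S l (Suc (Suc j)))"
    by (rule edges_grow_forward[where s = p])
      (use E far_apart_converse[OF far] l p p_layer in \<open>auto simp: lay, simp add: j_def\<close>)
  then show ?thesis by (simp add: lay conv)
qed

section \<open>Routing by induction on the number of sources and the length\<close>

definition consistent :: "'a rel \<Rightarrow> 'a set \<Rightarrow> 'a set \<Rightarrow> nat \<Rightarrow> bool" where
  "consistent E S T l \<longleftrightarrow> finite S \<and> far_apart E S T l \<and>
     (\<exists>\<phi>. inj_on \<phi> S \<and> (\<forall>x\<in>S. \<phi> x \<in> T \<and> (x, \<phi> x) \<in> E ^^ l))"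

text \<open>The walks may permute the partners given by \<open>consistent\<close>. Injectivity
  compares equal times only; far apart sets exclude meetings at different times.\<close>

definition routable :: "'a rel \<Rightarrow> 'a set \<Rightarrow> 'a set \<Rightarrow> nat \<Rightarrow> bool" where
  "routable E S T l \<longleftrightarrow> (\<exists>p.
     (\<forall>x\<in>S. p x 0 = x \<and> p x l \<in> T \<and> (\<forall>i<l. (p x i, p x (Suc i)) \<in> E)) \<and>
     (\<forall>i\<le>l. inj_on (\<lambda>x. p x i) S))"

lemma walk_segment:
  assumes "\<forall>i<l. (p i, p (Suc i)) \<in> E" "i \<le> j" "j \<le> l"
  shows "(p i, p j) \<in> E ^^ (j - i)"
  using assms(2,3)
proof (induction j rule: dec_induct)
  case (step j)
  then show ?case using assms(1) relpow_Suc_I[of "p i" "p j" "j - i" E "p (Suc j)"]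
    by (simp add: Suc_diff_le)
qed simp

lemma walk_in_layer:
  assumes "p 0 \<in> S" "p l \<in> T" "\<forall>i<l. (p i, p (Suc i)) \<in> E" "i \<le> l"
  shows "p i \<in> layer E S T l i"
  using assms walk_segment[OF assms(3), of 0 i] walk_segment[OF assms(3), of i l]
  by (auto simp: layer_def)

lemma far_apart_subset: "far_apart E S T l \<Longrightarrow> S' \<subseteq> S \<Longrightarrow> T' \<subseteq> T \<Longrightarrow> far_apart E S' T' l"
  unfolding far_apart_def by blast

text \<open>If the first layer were smaller than \<open>S\<close>, then walks routing all but one point of \<open>S\<close> would
  cover it, so that the number of edges would increase across it in both directions.\<close>

lemma card_first_layer:
  assumes E: "finite E" "completes_squares E" "completes_squares (E\<inverse>)"
    and cons: "consistent E S T l" and l: "l \<ge> 1"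
    and routable: "\<And>S'. S' \<subset> S \<Longrightarrow> consistent E S' T l \<Longrightarrow> routable E S' T l"
  shows "card S \<le> card (layer E S T l 1)"
proof (rule ccontr)
  let ?A = "layer E S T l 0" and ?B = "layer E S T l 1" and ?C = "layer E S T l 2"
  assume less: "\<not> ?thesis"
  have finB: "finite ?B" using finite_layer_Suc[OF E(1), of S T l 0] by simp
  from cons obtain \<phi> where \<phi>: "inj_on \<phi> S" "\<And>x. x \<in> S \<Longrightarrow> \<phi> x \<in> T \<and> (x, \<phi> x) \<in> E ^^ l"
    and finS: "finite S" and far: "far_apart E S T l" by (auto simp: consistent_def)
  obtain x0 where x0: "x0 \<in> S" using less by fastforce
  show False
  proof (cases "l = 1")
    case True
    have "\<phi> ` S \<subseteq> ?B" using \<phi> True by (fastforce simp: layer_def)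
    then have "card (\<phi> ` S) \<le> card ?B" using finB card_mono by blast
    then show False using less card_image[OF \<phi>(1)] by simp
  next
    case False
    then have l2: "2 \<le> l" using l by simp
    \<comment> \<open>Dropping one source makes the hypothesis \<open>routable\<close> available and
      still leaves at least \<open>card ?B\<close> walks, which therefore cover the whole first
      layer.\<close>
    define S' where "S' = S - {x0}"
    have "consistent E S' T l"
      unfolding consistent_def
    proof (intro conjI exI[of _ \<phi>] ballI)
      show "far_apart E S' T l" using far by (auto simp: far_apart_def S'_def)
    qed (use \<phi> finS in \<open>auto simp: S'_def inj_on_def\<close>)
    then have "routable E S' T l" using routable x0 by (auto simp: S'_def)
    then obtain p where p: "\<And>x. x \<in> S' \<Longrightarrow> p x 0 = x \<and> p x l \<in> T \<and> (\<forall>i<l. (p x i, p x (Suc i)) \<in> E)"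
      and inj: "\<And>i. i \<le> l \<Longrightarrow> inj_on (\<lambda>x. p x i) S'" by (auto simp: routable_def)
    have lay: "p x i \<in> layer E S T l i" if "x \<in> S'" "i \<le> l" for x i
      by (rule walk_in_layer) (use p that in \<open>auto simp: S'_def\<close>)
    define q where "q = (\<lambda>x. p x 1)"
    have injq: "inj_on q S'" using inj l by (simp add: q_def)
    have "card (q ` S') = card S - 1"
      using card_image[OF injq] x0 finS by (simp add: S'_def)
    moreover have "q ` S' \<subseteq> ?B" using lay l by (auto simp: q_def)
    ultimately have q: "q ` S' = ?B" using less finB by (intro card_seteq) auto
    \<comment> \<open>The source whose walk passes through \<open>b\<close>; that walk supplies the
      successor and the predecessor of \<open>b\<close>.\<close>
    define r where "r = the_inv_into S' q"
    have r: "r b \<in> S'" "q (r b) = b" if "b \<in> ?B" for b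
      using that q injq by (auto simp: r_def the_inv_into_into f_the_inv_into_f)
    have injr: "inj_on r ?B" using r(2) by (metis inj_onI)
    have inj_p: "inj_on (\<lambda>b. p (r b) i) ?B" if "i \<le> l" for i
      using comp_inj_on[OF injr, of "\<lambda>x. p x i"] inj[OF that] r(1)
      by (auto simp: comp_def intro: inj_on_subset)
    have "p (r b) 2 \<in> ?C \<and> (b, p (r b) 2) \<in> E" if "b \<in> ?B" for b
    proof -
      have "(p (r b) 1, p (r b) (Suc 1)) \<in> E" using p[OF r(1)[OF that]] l2 by simp
      then show ?thesis using r[OF that] lay l2 by (auto simp: q_def numeral_2_eq_2)
    qed
    then have forward: "card (E \<inter> ?A \<times> ?B) + card ?B \<le> card (E \<inter> ?B \<times> ?C)"
      using edges_grow_forward[OF E(1,2) far, of 0 "\<lambda>b. p (r b) 2"] inj_p[OF l2] l2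
      by (simp add: numeral_2_eq_2)
    have "p (r b) 0 \<in> ?A \<and> (p (r b) 0, b) \<in> E" if "b \<in> ?B" for b
    proof -
      have "(p (r b) 0, p (r b) (Suc 0)) \<in> E" using p[OF r(1)[OF that]] l by (auto dest!: spec[of _ 0])
      then show ?thesis using r[OF that] lay[of _ 0] by (auto simp: q_def)
    qed
    then have backward: "card (E \<inter> ?B \<times> ?C) + card ?B \<le> card (E \<inter> ?A \<times> ?B)"
      using edges_grow_backward[OF E(1,3) far, of 0 "\<lambda>b. p (r b) 0"] inj_p[of 0] l2
      by (simp add: numeral_2_eq_2)
    \<comment> \<open>The two inequalities conflict only if the layer is nonempty; the walk of the
      dropped source \<open>x0\<close> provides a vertex in it.\<close>
    obtain z where "(x0, z) \<in> E" "(z, \<phi> x0) \<in> E ^^ (l - 1)"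
      using \<phi>(2)[OF x0] l relpow_Suc_E2[of x0 "\<phi> x0" "l - 1" E] by (metis Suc_diff_le diff_Suc_1 One_nat_def)
    then have "z \<in> ?B" using x0 \<phi>(2)[OF x0] by (auto simp: layer_def)
    then have "card ?B > 0" using finB card_gt_0_iff by blast
    then show False using forward backward by simp
  qed
qed

text \<open>Hall's condition for the bipartite graph with sides \<open>S + L\<close> and \<open>L + T\<close>, where \<open>L\<close> is the
  first layer and each point of \<open>L\<close> is joined to its own copy, is the statement of Menger's theorem
  for walks from \<open>S\<close> through \<open>L\<close> to \<open>T\<close>.\<close>

lemma matching_through_first_layer:
  assumes E: "finite E" and cons: "consistent E S T (Suc l)"
    and large: "\<And>S' T'. S' \<subseteq> S \<Longrightarrow> T' \<subseteq> T \<Longrightarrow> consistent E S' T' (Suc l) \<Longrightarrow> card S' \<le> card (layer E S' T' (Suc l) 1)"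
  shows "\<exists>s t. inj_on s S \<and> inj_on t S \<and> (\<forall>x\<in>S. (x, s x) \<in> E \<and> (s x, t x) \<in> E ^^ l \<and> t x \<in> T)"
proof -
  let ?L = "layer E S T (Suc l) 1"
  have finL: "finite ?L" using finite_layer_Suc[OF E, of S T "Suc l" 0] by simp
  from cons obtain \<phi> where \<phi>: "inj_on \<phi> S" "\<And>x. x \<in> S \<Longrightarrow> \<phi> x \<in> T \<and> (x, \<phi> x) \<in> E ^^ Suc l"
    and finS: "finite S" and far: "far_apart E S T (Suc l)" unfolding consistent_def by blast
  define N where "N = (\<lambda>x. {z\<in>?L. (x, z) \<in> E})"
  define R where "R = (\<lambda>z. {t\<in>T. (z, t) \<in> E ^^ l})"
  have finR: "finite (R z)" if "z \<in> ?L" for z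
  proof (rule finite_subset)
    show "R z \<subseteq> insert z (Range E)"
      unfolding R_def by (cases l) auto
  qed (use E finite_Range in auto)
  \<comment> \<open>The choice \<open>Inl z\<close> for the copy of \<open>z\<close> means that no
    walk uses \<open>z\<close>; once a source takes \<open>Inl z\<close>, the copy must choose a
    target in \<open>R z\<close>.\<close>
  define A where "A = case_sum (\<lambda>x. Inl ` N x) (\<lambda>z. insert (Inl z) (Inr ` R z))"
  have "\<exists>h. inj_on h (S <+> ?L) \<and> (\<forall>i\<in>S <+> ?L. h i \<in> A i)"
  proof (rule hall)
    fix J assume J: "J \<subseteq> S <+> ?L"
    define S1 where "S1 = Inl -` J"
    define Z where "Z = Inr -` J"
    have SZ: "J = S1 <+> Z" "S1 \<subseteq> S" "Z \<subseteq> ?L"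
      using J by (auto simp: S1_def Z_def)
    have fin: "finite S1" "finite Z" using SZ finS finL finite_subset by auto
    define T0 where "T0 = (\<Union>z\<in>Z. R z)"
    \<comment> \<open>The other sources in \<open>S1\<close> inject into \<open>T0\<close> by
      \<open>\<phi>\<close>. The first layer between \<open>S2\<close> and its partners avoids
      \<open>Z\<close>, so \<open>large\<close> supplies \<open>card S2\<close> neighbours outside
      \<open>Z\<close>.\<close>
    define S2 where "S2 = {x\<in>S1. \<phi> x \<notin> T0}"
    have finT0: "finite T0" using fin finR SZ by (auto simp: T0_def)
    have "card (S1 - S2) \<le> card T0"
      by (rule card_inj_on_le[of \<phi>])
        (use \<phi>(1) SZ finT0 in \<open>auto simp: S2_def inj_on_def\<close>)
    then have S12: "card S1 \<le> card S2 + card T0"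
      using card_Diff_subset[of S2 S1] fin by (auto simp: S2_def)
    have "consistent E S2 (\<phi> ` S2) (Suc l)"
      unfolding consistent_def
    proof (intro conjI exI[of _ \<phi>] ballI)
      show "far_apart E S2 (\<phi> ` S2) (Suc l)"
        by (rule far_apart_subset[OF far]) (use \<phi> SZ in \<open>auto simp: S2_def\<close>)
      show "inj_on \<phi> S2" using \<phi>(1) SZ by (auto simp: S2_def inj_on_def)
      show "(x, \<phi> x) \<in> E ^^ Suc l" if "x \<in> S2" for x using \<phi>(2)[of x] SZ that by (auto simp: S2_def)
    qed (use fin in \<open>auto simp: S2_def\<close>)
    then have "card S2 \<le> card (layer E S2 (\<phi> ` S2) (Suc l) 1)"
      using large[of S2 "\<phi> ` S2"] SZ \<phi>(2) by (auto simp: S2_def)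
    also have "\<dots> \<le> card ((\<Union>x\<in>S1. N x) - Z)"
    proof (rule card_mono)
      show "finite ((\<Union>x\<in>S1. N x) - Z)" by (rule finite_subset[OF _ finL]) (auto simp: N_def)
      show "layer E S2 (\<phi> ` S2) (Suc l) 1 \<subseteq> (\<Union>x\<in>S1. N x) - Z"
      proof
        fix z assume "z \<in> layer E S2 (\<phi> ` S2) (Suc l) 1"
        then obtain x x' where z: "x \<in> S2" "x' \<in> S2" "(x, z) \<in> E" "(z, \<phi> x') \<in> E ^^ l"
          by (auto simp: layer_def)
        have x: "x \<in> S1" "x \<in> S" "x' \<in> S" "\<phi> x' \<notin> T0" using z SZ by (auto simp: S2_def)
        have "z \<in> ?L" unfolding layer_def using z x \<phi>(2)[of x'] by auto
        moreover have "z \<notin> Z" using x(4) z(4) \<phi>(2)[OF x(3)] by (auto simp: T0_def R_def)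
        ultimately show "z \<in> (\<Union>x\<in>S1. N x) - Z" using x z by (auto simp: N_def)
      qed
    qed
    finally have S2: "card S2 \<le> card ((\<Union>x\<in>S1. N x) - Z)" .
    have U: "(\<Union>i\<in>J. A i) = (((\<Union>x\<in>S1. N x) - Z) \<union> Z) <+> T0"
      by (auto simp: SZ(1) A_def T0_def)
    have finN: "finite ((\<Union>x\<in>S1. N x) - Z)" by (rule finite_subset[OF _ finL]) (auto simp: N_def)
    have "card (\<Union>i\<in>J. A i) = card ((\<Union>x\<in>S1. N x) - Z) + card Z + card T0"
      unfolding U using finN fin finT0 by (simp add: card_Plus del: Un_Diff_cancel2, subst card_Un_disjoint) auto
    moreover have "card J = card S1 + card Z"
      using fin by (simp add: SZ(1) card_Plus)
    ultimately show "card J \<le> card (\<Union>i\<in>J. A i)" using S12 S2 by simp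
  next
    fix i assume "i \<in> S <+> ?L"
    moreover have "finite (N x)" for x by (rule finite_subset[OF _ finL]) (auto simp: N_def)
    ultimately show "finite (A i)" using finR by (auto simp: A_def)
  qed (use finS finL in auto)
  then obtain h where h: "inj_on h (S <+> ?L)" "\<And>i. i \<in> S <+> ?L \<Longrightarrow> h i \<in> A i" by blast
  have s: "\<exists>z. h (Inl x) = Inl z \<and> z \<in> ?L \<and> (x, z) \<in> E" if "x \<in> S" for x
    using h(2)[of "Inl x"] that by (auto simp: A_def N_def)
  then obtain s where s: "\<And>x. x \<in> S \<Longrightarrow> h (Inl x) = Inl (s x) \<and> s x \<in> ?L \<and> (x, s x) \<in> E" by metis
  \<comment> \<open>The value \<open>Inl (s x)\<close> is already taken by \<open>Inl x\<close>, so
    the copy of \<open>s x\<close> must choose a target.\<close>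
  have "\<exists>t. h (Inr (s x)) = Inr t \<and> t \<in> R (s x)" if "x \<in> S" for x
  proof -
    have "h (Inr (s x)) \<noteq> h (Inl x)" using s[OF that] that by (subst inj_on_eq_iff[OF h(1)]) auto
    then show ?thesis using h(2)[of "Inr (s x)"] s[OF that] by (auto simp: A_def)
  qed
  then obtain t where t: "\<And>x. x \<in> S \<Longrightarrow> h (Inr (s x)) = Inr (t x) \<and> t x \<in> R (s x)" by metis
  have injs: "inj_on s S"
  proof (rule inj_onI)
    fix x y assume xy: "x \<in> S" "y \<in> S" "s x = s y"
    then have "h (Inl x) = h (Inl y)" using s by metis
    then show "x = y" using inj_onD[OF h(1)] xy by blast
  qed
  moreover have "inj_on t S"
  proof (rule inj_onI)
    fix x y assume xy: "x \<in> S" "y \<in> S" "t x = t y"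
    then have "h (Inr (s x)) = h (Inr (s y))" using t by metis
    then have "s x = s y" using inj_onD[OF h(1)] xy s by blast
    then show "x = y" using inj_onD[OF injs] xy by blast
  qed
  ultimately show ?thesis using s t unfolding R_def by blast
qed

text \<open>This is a variant of the routing theorem of Lehman and Ron for the hypercube.\<close>

theorem consistent_imp_routable:
  assumes E: "finite E" "completes_squares E" "completes_squares (E\<inverse>)"
    and "consistent E S T l"
  shows "routable E S T l"
  using assms(4)
proof (induction "card S" arbitrary: S T l rule: less_induct)
  case less
  note IH = less.hyps
  \<comment> \<open>Advancing all sources by one edge keeps their number and shortens the walks,
    hence an inner induction on the length; the outer hypothesis serves proper subsets.\<close>
  have "routable E S' T' l'"
    if "consistent E S' T' l'" "card S' = card S" for S' T' l'
    using that
  proof (induction l' arbitrary: S' T')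
    case 0
    then obtain \<phi> where "\<forall>x\<in>S'. \<phi> x \<in> T' \<and> (x, \<phi> x) \<in> E ^^ 0" unfolding consistent_def by blast
    then show ?case unfolding routable_def by (intro exI[of _ "\<lambda>x i. x"]) auto
  next
    case (Suc l')
    have finS: "finite S'" and far: "far_apart E S' T' (Suc l')"
      using Suc.prems by (auto simp: consistent_def)
    have "card S1 \<le> card (layer E S1 T1 (Suc l') 1)"
      if S1: "S1 \<subseteq> S'" "T1 \<subseteq> T'" "consistent E S1 T1 (Suc l')" for S1 T1
    proof (rule card_first_layer[OF E S1(3)])
      fix S2 assume "S2 \<subset> S1" "consistent E S2 T1 (Suc l')"
      moreover from this have "card S2 < card S"
        using S1(1) finS Suc.prems(2) by (metis psubset_card_mono psubset_subset_trans)
      ultimately show "routable E S2 T1 (Suc l')" using IH by blast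
    qed simp
    from matching_through_first_layer[OF E(1) Suc.prems(1) this] obtain s t
      where st: "inj_on s S'" "inj_on t S'"
        "\<And>x. x \<in> S' \<Longrightarrow> (x, s x) \<in> E \<and> (s x, t x) \<in> E ^^ l' \<and> t x \<in> T'" by blast
    have "consistent E (s ` S') T' l'"
      unfolding consistent_def
    proof (intro conjI exI[of _ "t \<circ> the_inv_into S' s"] ballI)
      show "far_apart E (s ` S') T' l'"
        unfolding far_apart_def
      proof (intro ballI allI impI)
        fix z y k assume "z \<in> s ` S'" "y \<in> T'" "(z, y) \<in> E ^^ k"
        then obtain x where x: "x \<in> S'" "(x, y) \<in> E ^^ Suc k" using st(3) relpow_Suc_I2 by (metis imageE)
        then have "Suc l' \<le> Suc k" using far \<open>y \<in> T'\<close> unfolding far_apart_def by blast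
        then show "l' \<le> k" by simp
      qed
      show "inj_on (t \<circ> the_inv_into S' s) (s ` S')"
        using st(1,2) by (intro comp_inj_on inj_on_the_inv_into) (auto simp: the_inv_into_onto)
    qed (use finS st in \<open>auto simp: the_inv_into_f_f\<close>)
    moreover have "card (s ` S') = card S" using card_image[OF st(1)] Suc.prems(2) by simp
    ultimately have "routable E (s ` S') T' l'" by (rule Suc.IH)
    then obtain p where p: "\<And>z. z \<in> s ` S' \<Longrightarrow> p z 0 = z \<and> p z l' \<in> T' \<and> (\<forall>i<l'. (p z i, p z (Suc i)) \<in> E)"
      and inj: "\<And>i. i \<le> l' \<Longrightarrow> inj_on (\<lambda>z. p z i) (s ` S')" by (auto simp: routable_def)
    define q where "q = (\<lambda>x i. case i of 0 \<Rightarrow> x | Suc j \<Rightarrow> p (s x) j)"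
    show ?case
      unfolding routable_def
    proof (intro exI[of _ q] conjI ballI allI impI)
      fix x i assume "x \<in> S'" "i < Suc l'"
      then show "(q x i, q x (Suc i)) \<in> E"
        using p[of "s x"] st(3) by (auto simp: q_def split: nat.splits)
    next
      fix i assume "i \<le> Suc l'"
      then show "inj_on (\<lambda>x. q x i) S'"
        using comp_inj_on[OF st(1) inj] by (cases i) (auto simp: q_def comp_def)
    qed (use p in \<open>auto simp: q_def\<close>)
  qed
  then show ?case using less.prems by blast
qed

section \<open>Matchings\<close>

definition endpoints :: "('a \<times> 'a) set \<Rightarrow> 'a set" where
  "endpoints M = fst ` M \<union> snd ` M"

lemma card_endpoints_le:
  assumes "finite M"
  shows "card (endpoints M) \<le> 2 * card M"
  using card_Un_le[of "fst ` M" "snd ` M"] card_image_le[OF assms, of fst]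
    card_image_le[OF assms, of snd] by (simp add: endpoints_def)

lemma is_matching_disjoint:
  assumes "is_matching E M" "(x, y) \<in> M" "(x', y') \<in> M" "(x, y) \<noteq> (x', y')"
  shows "{x, y} \<inter> {x', y'} = {}"
  using pairwiseD[of _ M "(x, y)" "(x', y')"] assms by (auto simp: is_matching_def disjnt_def)

lemma is_matching_fst_eq: "is_matching E M \<Longrightarrow> (x, y) \<in> M \<Longrightarrow> (x, y') \<in> M \<Longrightarrow> y = y'"
  using is_matching_disjoint[of E M x y x y'] by auto

lemma is_matching_snd_eq: "is_matching E M \<Longrightarrow> (x, y) \<in> M \<Longrightarrow> (x', y) \<in> M \<Longrightarrow> x = x'"
  using is_matching_disjoint[of E M x y x' y] by auto

lemma is_matching_subset:
  assumes "is_matching E M" "M' \<subseteq> M" "M' \<subseteq> E'"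
  shows "is_matching E' M'"
  using assms pairwise_subset unfolding is_matching_def by blast

lemma is_matching_insert:
  assumes "is_matching E M" "(x, y) \<in> E" "x \<notin> endpoints M" "y \<notin> endpoints M"
  shows "is_matching E (insert (x, y) M)"
proof -
  have "disjnt {x, y} {x', y'}" if "(x', y') \<in> M" for x' y'
    using assms(3,4) that by (force simp: endpoints_def disjnt_def)
  moreover from this have "disjnt {x', y'} {x, y}" if "(x', y') \<in> M" for x' y'
    using that disjnt_sym by blast
  ultimately show ?thesis
    using assms(1,2) by (auto simp: is_matching_def pairwise_insert)
qed

text \<open>An uncovered edge could be added to \<open>M\<close>.\<close>

lemma is_maximal_matching_covers:
  assumes "is_maximal_matching E M" "(x, y) \<in> E"
  shows "x \<in> endpoints M \<or> y \<in> endpoints M"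
proof (rule ccontr)
  assume *: "\<not> ?thesis"
  then have "is_matching E (insert (x, y) M)"
    using is_matching_insert assms by (metis is_maximal_matching_def)
  moreover have "(x, y) \<notin> M" using * by (force simp: endpoints_def)
  ultimately show False using assms(1) unfolding is_maximal_matching_def by blast
qed

lemma is_matching_extend:
  assumes "finite E" "is_matching E M"
  shows "\<exists>M'. M \<subseteq> M' \<and> is_maximal_matching E M'"
  using finite_has_maximal2[OF finite_matchings[OF assms(1)], of M] assms(2)
  unfolding is_maximal_matching_def by auto

text \<open>Each pair of \<open>P\<close> has an endpoint covered by \<open>N\<close>, and disjoint
  pairs yield different endpoints.\<close>

lemma card_matching_le_twice_maximal:
  assumes "finite E" "is_maximal_matching E N" "is_matching E P"
  shows "card P \<le> 2 * card N"
proof -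
  have "finite N" using assms(1,2) finite_subset by (auto simp: is_maximal_matching_def is_matching_def)
  define g where "g = (\<lambda>(x, y). if x \<in> endpoints N then x else y)"
  have P: "P \<subseteq> E" using assms(3) by (simp add: is_matching_def)
  have "card P \<le> card (endpoints N)"
  proof (rule card_inj_on_le)
    show "inj_on g P"
      by (rule inj_onI) (use is_matching_disjoint[OF assms(3)] in \<open>fastforce simp: g_def split: if_splits\<close>)
    show "g ` P \<subseteq> endpoints N"
      using is_maximal_matching_covers[OF assms(2)] P by (fastforce simp: g_def)
    show "finite (endpoints N)" using \<open>finite N\<close> by (simp add: endpoints_def)
  qed
  then show ?thesis using card_endpoints_le[OF \<open>finite N\<close>] by linarith
qed

text \<open>The matching is extended to a maximal one at each successive threshold. A pair enters
  when the threshold reaches its weight; a lighter \<open>(x, y')\<close> would have had an endpoint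
  covered before that.\<close>

lemma greedy_matching:
  fixes w :: "'a \<times> 'a \<Rightarrow> nat"
  assumes "finite E"
  shows "\<exists>N. is_maximal_matching {e\<in>E. w e \<le> k} N \<and>
    (\<forall>x y x' y'. (x, y) \<in> N \<longrightarrow> (x', y') \<in> N \<longrightarrow> w (x, y) = w (x', y') \<longrightarrow> (x, y') \<in> E \<longrightarrow>
       w (x, y) \<le> w (x, y'))"
proof (induction k)
  case 0
  obtain N where N: "is_maximal_matching {e\<in>E. w e \<le> 0} N"
    using maximal_matching_exists[of "{e\<in>E. w e \<le> 0}"] assms by auto
  then have "N \<subseteq> {e\<in>E. w e \<le> 0}" by (auto simp: is_maximal_matching_def is_matching_def)
  then show ?case using N by (intro exI[of _ N]) auto
next
  case (Suc k)
  then obtain N where N: "is_maximal_matching {e\<in>E. w e \<le> k} N"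
    and opt: "\<And>x y x' y'. (x, y) \<in> N \<Longrightarrow> (x', y') \<in> N \<Longrightarrow> w (x, y) = w (x', y') \<Longrightarrow> (x, y') \<in> E \<Longrightarrow>
       w (x, y) \<le> w (x, y')" by blast
  have N': "N \<subseteq> {e\<in>E. w e \<le> k}" using N by (auto simp: is_maximal_matching_def is_matching_def)
  have "is_matching {e\<in>E. w e \<le> Suc k} N"
    by (rule is_matching_subset[of "{e\<in>E. w e \<le> k}" N])
      (use N N' in \<open>auto simp: is_maximal_matching_def\<close>)
  then obtain N2 where N2: "N \<subseteq> N2" "is_maximal_matching {e\<in>E. w e \<le> Suc k} N2"
    using is_matching_extend[of "{e\<in>E. w e \<le> Suc k}" N] assms by auto
  have match: "is_matching {e\<in>E. w e \<le> Suc k} N2" and sub: "N2 \<subseteq> {e\<in>E. w e \<le> Suc k}"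
    using N2(2) by (auto simp: is_maximal_matching_def is_matching_def)
  have new: "x \<notin> endpoints N \<and> y \<notin> endpoints N" if "(x, y) \<in> N2" "(x, y) \<notin> N" for x y
  proof -
    have "{x, y} \<inter> {x', y'} = {}" if "(x', y') \<in> N" for x' y'
      by (rule is_matching_disjoint[OF match]) (use that \<open>(x, y) \<in> N2\<close> \<open>(x, y) \<notin> N\<close> N2(1) in auto)
    then show ?thesis by (fastforce simp: endpoints_def)
  qed
  have covered: "x \<in> endpoints N \<or> y \<in> endpoints N" if "(x, y) \<in> E" "w (x, y) \<le> k" for x y
    using is_maximal_matching_covers[OF N, of x y] that by simp
  have "w (x, y) \<le> w (x, y')"
    if h: "(x, y) \<in> N2" "(x', y') \<in> N2" "w (x, y) = w (x', y')" "(x, y') \<in> E" for x y x' y'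
  proof (cases "w (x, y) \<le> k")
    case True
    \<comment> \<open>Pairs added at this stage have both endpoints uncovered by \<open>N\<close>,
      so their weight exceeds \<open>k\<close>.\<close>
    then have "(x, y) \<in> N" "(x', y') \<in> N" using new covered sub h by fastforce+
    then show ?thesis using opt h by blast
  next
    case False
    \<comment> \<open>Both pairs are new, so \<open>N\<close> covers neither \<open>x\<close> nor
      \<open>y'\<close>.\<close>
    then have "(x, y) \<notin> N" "(x', y') \<notin> N" using N' h(3) by auto
    then have "\<not> w (x, y') \<le> k" using new covered h by blast
    moreover have "w (x, y) \<le> Suc k" using sub h(1) by auto
    ultimately show ?thesis by simp
  qed
  then show ?case using N2(2) by blast
qed

section \<open>The augmented hypergrid\<close>

lemma finite_hypergrid: "finite (hypergrid n d)"
  by (simp add: hypergrid_def finite_PiE)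

lemma augmented_hypergrid_iff:
  "(x, y) \<in> augmented_hypergrid n d \<longleftrightarrow>
     x \<in> hypergrid n d \<and> (\<exists>i\<in>{1..d}. \<exists>a. y = x(i := x i + 2 ^ a) \<and> x i + 2 ^ a \<le> n)"
  (is "?L \<longleftrightarrow> ?R")
proof
  assume ?L
  then have xy: "x \<in> hypergrid n d" "y \<in> hypergrid n d"
    and "\<exists>i\<in>{1..d}. {j \<in> {1..d}. x j \<noteq> y j} = {i} \<and> (\<exists>a. y i = x i + 2 ^ a)"
    unfolding augmented_hypergrid_def by simp_all
  then obtain i a where i: "i \<in> {1..d}" "{j \<in> {1..d}. x j \<noteq> y j} = {i}" "y i = x i + 2 ^ a"
    by (elim bexE conjE exE)
  have eq_outside: "x j = y j" if "j \<in> {1..d}" "j \<noteq> i" for j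
    using equalityD1[OF i(2)] that by blast
  have "y j = (x(i := x i + 2 ^ a)) j" for j
  proof (cases "j \<in> {1..d}")
    case True
    then show ?thesis using i(3) eq_outside by (cases "j = i") auto
  next
    case False
    then show ?thesis using xy i(1) by (auto simp: hypergrid_def PiE_def extensional_def)
  qed
  moreover have "y i \<le> n" using xy(2) i(1) by (auto simp: hypergrid_def PiE_iff)
  ultimately have "y = x(i := x i + 2 ^ a) \<and> x i + 2 ^ a \<le> n" using i(3) by (simp add: fun_eq_iff)
  then show ?R using xy(1) i(1) by blast
next
  assume ?R
  then obtain i a where xy: "x \<in> hypergrid n d" "i \<in> {1..d}" "y = x(i := x i + 2 ^ a)" "x i + 2 ^ a \<le> n"
    by (elim conjE bexE exE)
  then have "y \<in> hypergrid n d" by (auto simp: hypergrid_def PiE_iff extensional_def trans_le_add1)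
  moreover have "{j \<in> {1..d}. x j \<noteq> y j} = {i}" using xy by auto
  ultimately show ?L using xy by (auto simp: augmented_hypergrid_def)
qed

lemma finite_augmented_hypergrid: "finite (augmented_hypergrid n d)"
  by (rule finite_subset[of _ "hypergrid n d \<times> hypergrid n d"])
    (auto simp: augmented_hypergrid_def finite_hypergrid)

text \<open>Two consecutive steps can be exchanged, unless they coincide; in that case they are replaced
  by a single step of twice the length.\<close>

lemma augmented_hypergrid_exchange:
  assumes "(u, z) \<in> augmented_hypergrid n d" "(z, v) \<in> augmented_hypergrid n d"
    "(u, v) \<notin> augmented_hypergrid n d"
    and z: "z = u(i := u i + 2 ^ a)" and v: "v = z(j := z j + 2 ^ b)"
    and ij: "i \<in> {1..d}" "j \<in> {1..d}"
  shows "(u, u(j := u j + 2 ^ b)) \<in> augmented_hypergrid n d"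
    "(u(j := u j + 2 ^ b), v) \<in> augmented_hypergrid n d" "u(j := u j + 2 ^ b) \<noteq> z"
proof -
  have grid: "u \<in> hypergrid n d" "z \<in> hypergrid n d" "v \<in> hypergrid n d"
    using assms(1,2) by (auto simp: augmented_hypergrid_def)
  have le: "v j \<le> n" "v i \<le> n" using grid(3) ij by (auto simp: hypergrid_def PiE_iff)
  have uz: "u j \<le> z j" "z i \<le> v i" using z v by auto
  have "u j + 2 ^ b \<le> n" using le(1) uz(1) v by simp
  then show e: "(u, u(j := u j + 2 ^ b)) \<in> augmented_hypergrid n d"
    using grid(1) ij by (auto simp: augmented_hypergrid_iff)
  have "u(j := u j + 2 ^ b) \<in> hypergrid n d" using e by (auto simp: augmented_hypergrid_def)
  moreover have "v = (u(j := u j + 2 ^ b))(i := (u(j := u j + 2 ^ b)) i + 2 ^ a)"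
    using z v by (auto simp: fun_eq_iff)
  moreover from this have "(u(j := u j + 2 ^ b)) i + 2 ^ a \<le> n" using le(2) by (metis fun_upd_same)
  ultimately show "(u(j := u j + 2 ^ b), v) \<in> augmented_hypergrid n d"
    using ij unfolding augmented_hypergrid_iff by blast
  show "u(j := u j + 2 ^ b) \<noteq> z"
  proof
    assume eq: "u(j := u j + 2 ^ b) = z"
    have "i = j"
    proof (rule ccontr)
      assume "i \<noteq> j"
      then have "z i = u i" using eq by auto
      then show False using z by simp
    qed
    then have "(2::nat) ^ a = 2 ^ b" using eq z by (metis add_left_cancel fun_upd_same)
    then have v': "v = u(i := u i + 2 ^ Suc a)" using z v \<open>i = j\<close> by auto
    then have "u i + 2 ^ Suc a \<le> n" using le(2) by simp
    then show False using assms(3) v' grid(1) ij unfolding augmented_hypergrid_iff by blast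
  qed
qed

lemma completes_squares_augmented_hypergrid: "completes_squares (augmented_hypergrid n d)"
  unfolding completes_squares_def
proof (intro allI impI)
  fix z v assume zv: "(z, v) \<in> augmented_hypergrid n d"
  then obtain j b where j: "j \<in> {1..d}" "v = z(j := z j + 2 ^ b)" by (auto simp: augmented_hypergrid_iff)
  show "\<exists>g. inj_on g {u. (u, z) \<in> augmented_hypergrid n d} \<and>
    (\<forall>u. (u, z) \<in> augmented_hypergrid n d \<and> (u, v) \<notin> augmented_hypergrid n d \<longrightarrow>
       (u, g u) \<in> augmented_hypergrid n d \<and> (g u, v) \<in> augmented_hypergrid n d \<and> g u \<noteq> z)"
  \<comment> \<open>The other corner of the square takes the step from \<open>z\<close> to
    \<open>v\<close> first; as a translation of coordinate \<open>j\<close> this map is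
    injective.\<close>
  proof (intro exI[of _ "\<lambda>u. u(j := u j + 2 ^ b)"] conjI allI impI)
    show "inj_on (\<lambda>u. u(j := u j + 2 ^ b)) {u. (u, z) \<in> augmented_hypergrid n d}"
    proof (rule inj_onI)
      fix u u' :: point
      assume eq: "u(j := u j + 2 ^ b) = u'(j := u' j + 2 ^ b)"
      show "u = u'"
      proof
        fix k show "u k = u' k" using fun_cong[OF eq, of k] by (cases "k = j") auto
      qed
    qed
    fix u assume u: "(u, z) \<in> augmented_hypergrid n d \<and> (u, v) \<notin> augmented_hypergrid n d"
    then obtain i a where i: "i \<in> {1..d}" "z = u(i := u i + 2 ^ a)" by (auto simp: augmented_hypergrid_iff)
    note * = augmented_hypergrid_exchange[OF conjunct1[OF u] zv conjunct2[OF u] i(2) j(2) i(1) j(1)]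
    show "(u, u(j := u j + 2 ^ b)) \<in> augmented_hypergrid n d"
      "(u(j := u j + 2 ^ b), v) \<in> augmented_hypergrid n d" "u(j := u j + 2 ^ b) \<noteq> z"
      by (fact *)+
  qed
qed

lemma completes_squares_augmented_hypergrid_converse: "completes_squares ((augmented_hypergrid n d)\<inverse>)"
  unfolding completes_squares_def converse_iff
proof (intro allI impI)
  fix z u assume uz: "(u, z) \<in> augmented_hypergrid n d"
  then obtain i a where i: "i \<in> {1..d}" "z = u(i := u i + 2 ^ a)" by (auto simp: augmented_hypergrid_iff)
  show "\<exists>g. inj_on g {v. (z, v) \<in> augmented_hypergrid n d} \<and>
    (\<forall>v. (z, v) \<in> augmented_hypergrid n d \<and> (u, v) \<notin> augmented_hypergrid n d \<longrightarrow>
       (g v, v) \<in> augmented_hypergrid n d \<and> (u, g v) \<in> augmented_hypergrid n d \<and> g v \<noteq> z)"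
  \<comment> \<open>Undoing the first step at \<open>v\<close> reaches the same corner.\<close>
  proof (intro exI[of _ "\<lambda>v. v(i := v i - 2 ^ a)"] conjI allI impI)
    show "inj_on (\<lambda>v. v(i := v i - 2 ^ a)) {v. (z, v) \<in> augmented_hypergrid n d}"
    proof (rule inj_onI)
      fix v v' :: point
      assume v: "v \<in> {v. (z, v) \<in> augmented_hypergrid n d}" "v' \<in> {v. (z, v) \<in> augmented_hypergrid n d}"
        and eq: "v(i := v i - 2 ^ a) = v'(i := v' i - 2 ^ a)"
      \<comment> \<open>Truncated subtraction is injective here because out-neighbours of
        \<open>z\<close> keep the \<open>2 ^ a\<close> gained from \<open>u\<close>.\<close>
      have "2 ^ a \<le> v i" "2 ^ a \<le> v' i" using v i(2) by (auto simp: augmented_hypergrid_iff)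
      show "v = v'"
      proof
        fix k show "v k = v' k"
          using fun_cong[OF eq, of k] \<open>2 ^ a \<le> v i\<close> \<open>2 ^ a \<le> v' i\<close> by (cases "k = i") auto
      qed
    qed
    fix v assume v: "(z, v) \<in> augmented_hypergrid n d \<and> (u, v) \<notin> augmented_hypergrid n d"
    then obtain j b where j: "j \<in> {1..d}" "v = z(j := z j + 2 ^ b)" by (auto simp: augmented_hypergrid_iff)
    have g: "v(i := v i - 2 ^ a) = u(j := u j + 2 ^ b)"
      using i(2) j(2) by (auto simp: fun_eq_iff)
    note * = augmented_hypergrid_exchange[OF uz conjunct1[OF v] conjunct2[OF v] i(2) j(2) i(1) j(1)]
    show "(v(i := v i - 2 ^ a), v) \<in> augmented_hypergrid n d"
      "(u, v(i := v i - 2 ^ a)) \<in> augmented_hypergrid n d" "v(i := v i - 2 ^ a) \<noteq> z"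
      unfolding g by (fact *)+
  qed
qed

section \<open>Walks and distances in the augmented hypergrid\<close>

lemma augmented_walk_le: "(x, y) \<in> augmented_hypergrid n d ^^ k \<Longrightarrow> x \<le> y"
proof (induction k arbitrary: y)
  case (Suc k)
  then obtain z where z: "x \<le> z" "(z, y) \<in> augmented_hypergrid n d" by (metis relpow_Suc_E)
  then have "z \<le> y" by (auto simp: augmented_hypergrid_iff le_fun_def)
  then show ?case using z(1) by simp
qed simp

lemma augmented_dist_le: "(x, y) \<in> augmented_hypergrid n d ^^ k \<Longrightarrow> augmented_dist n d x y \<le> k"
  unfolding augmented_dist_def by (rule Least_le)

lemma augmented_dist_walk:
  assumes "(x, y) \<in> violation_graph n d f"
  shows "(x, y) \<in> augmented_hypergrid n d ^^ augmented_dist n d x y"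
  unfolding augmented_dist_def
  by (rule LeastI_ex[OF augmented_hypergrid_connected])
    (use assms in \<open>auto simp: violation_graph_def\<close>)

lemma augmented_dist_pos:
  assumes "(x, y) \<in> violation_graph n d f"
  shows "augmented_dist n d x y \<ge> 1"
proof (rule ccontr)
  assume "\<not> ?thesis"
  then have "x = y" using augmented_dist_walk[OF assms] by (cases "augmented_dist n d x y") auto
  then show False using assms by (simp add: violation_graph_def)
qed

section \<open>Violations of monotonicity\<close>

text \<open>Outside the endpoints of a maximal matching there are no violations, so the restriction of
  \<open>f\<close> to these points extends to a monotone function.\<close>

lemma far_from_monotone_card_maximal_matching:
  assumes f: "f \<in> hypergrid n d \<rightarrow> {0, 1}" and far: "far_from_monotone n d \<epsilon> f"
    and M: "is_maximal_matching (violation_graph n d f) M"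
  shows "\<epsilon> * real n ^ d \<le> 2 * real (card M)"
proof -
  have "M \<subseteq> violation_graph n d f" using M by (auto simp: is_maximal_matching_def is_matching_def)
  then have finM: "finite M" using finite_violation_graph finite_subset by blast
  \<comment> \<open>The indicator of the up-set generated by the 1-valued points that
    \<open>M\<close> leaves uncovered.\<close>
  define g :: "point \<Rightarrow> nat" where
    "g = (\<lambda>x. if \<exists>z \<in> hypergrid n d - endpoints M. z \<le> x \<and> f z = 1 then 1 else 0)"
  have "mono_on (hypergrid n d) g"
    by (rule mono_onI) (auto simp: g_def intro: order.trans)
  then have "\<epsilon> * real n ^ d \<le> real (card {x \<in> hypergrid n d. f x \<noteq> g x})"
    using far by (auto simp: far_from_monotone_def g_def)
  also have "card {x \<in> hypergrid n d. f x \<noteq> g x} \<le> card (endpoints M)"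
  proof (rule card_mono)
    show "finite (endpoints M)" using finM by (simp add: endpoints_def)
    show "{x \<in> hypergrid n d. f x \<noteq> g x} \<subseteq> endpoints M"
    proof
      fix x assume x: "x \<in> {x \<in> hypergrid n d. f x \<noteq> g x}"
      show "x \<in> endpoints M"
      proof (rule ccontr)
        assume out: "x \<notin> endpoints M"
        have "f x \<in> {0, 1}" using x f by blast
        then consider "f x = 1" | "f x = 0" by auto
        then show False
        proof cases
          case 1
          then have "\<exists>z \<in> hypergrid n d - endpoints M. z \<le> x \<and> f z = 1"
            using x out by (intro bexI[of _ x]) auto
          then have "g x = 1" by (simp add: g_def)
          then show False using 1 x by auto
        next
          case 2
          then obtain z where z: "z \<in> hypergrid n d" "z \<notin> endpoints M" "z \<le> x" "f z = 1"
            using x by (auto simp: g_def split: if_splits)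
          moreover from z(4) 2 have "z \<noteq> x" by auto
          ultimately have "(z, x) \<in> violation_graph n d f"
            using x 2 by (simp add: violation_graph_def order.not_eq_order_implies_strict)
          then show False using is_maximal_matching_covers[OF M] z(2) out by blast
        qed
      qed
    qed
  qed
  also have "card (endpoints M) \<le> 2 * card M" using finM by (rule card_endpoints_le)
  finally show ?thesis by simp
qed

section \<open>From a distance class to disjoint violating edges\<close>

lemma violating_step_exists:
  fixes v :: "nat \<Rightarrow> nat"
  assumes "v 0 = 1" "v l \<noteq> 1"
  shows "\<exists>i<l. v i = 1 \<and> v (Suc i) \<noteq> 1"
proof (rule ccontr)
  assume *: "\<not> ?thesis"
  have "i \<le> l \<Longrightarrow> v i = 1" for i
    by (induction i) (use * assms(1) in auto)
  then show False using assms(2) by blast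
qed

text \<open>Routing the lower endpoints to the upper ones gives disjoint walks from value 1 to value
  0, and \<open>f\<close> drops along some edge of each.\<close>

lemma violating_matching_from_distance_class:
  assumes f: "f \<in> hypergrid n d \<rightarrow> {0, 1}"
    and N: "is_matching (violation_graph n d f) N"
    and dist: "\<And>x y. (x, y) \<in> N \<Longrightarrow> augmented_dist n d x y = l"
    and far: "\<And>x y x' y'. (x, y) \<in> N \<Longrightarrow> (x', y') \<in> N \<Longrightarrow> (x, y') \<in> violation_graph n d f \<Longrightarrow>
      l \<le> augmented_dist n d x y'"
  shows "\<exists>M. is_matching (violating_edges n d f) M \<and> card M = card N"
proof -
  let ?E = "augmented_hypergrid n d"
  define S where "S = fst ` N"
  define T where "T = snd ` N"
  have NV: "N \<subseteq> violation_graph n d f" using N by (simp add: is_matching_def)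
  then have finN: "finite N" using finite_violation_graph finite_subset by blast
  have "\<forall>x\<in>S. \<exists>y. (x, y) \<in> N" by (auto simp: S_def)
  then obtain \<phi> where \<phi>: "\<And>x. x \<in> S \<Longrightarrow> (x, \<phi> x) \<in> N" by metis
  \<comment> \<open>A walk from \<open>x\<close> to \<open>y'\<close> forces
    \<open>x \<le> y'\<close>, so this pair is a violation and \<open>far\<close> applies to
    it.\<close>
  have farST: "far_apart ?E S T l"
    unfolding far_apart_def
  proof (intro ballI allI impI)
    fix x y' k assume xy: "x \<in> S" "y' \<in> T" "(x, y') \<in> ?E ^^ k"
    then obtain y x' where N': "(x, y) \<in> N" "(x', y') \<in> N" by (auto simp: S_def T_def)
    then have "(x, y) \<in> violation_graph n d f" "(x', y') \<in> violation_graph n d f" using NV by auto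
    moreover have "x \<le> y'" using xy(3) by (rule augmented_walk_le)
    moreover from calculation have "x \<noteq> y'" by (auto simp: violation_graph_def)
    ultimately have "(x, y') \<in> violation_graph n d f"
      by (simp add: violation_graph_def order.not_eq_order_implies_strict)
    then have "l \<le> augmented_dist n d x y'" using far N' by blast
    then show "l \<le> k" using augmented_dist_le[OF xy(3)] by simp
  qed
  have "consistent ?E S T l"
    unfolding consistent_def
  proof (intro conjI exI[of _ \<phi>] ballI)
    show "inj_on \<phi> S" using \<phi> is_matching_snd_eq[OF N] by (metis inj_onI)
    show "(x, \<phi> x) \<in> ?E ^^ l" if "x \<in> S" for x
      using augmented_dist_walk[of x "\<phi> x" n d f] dist[OF \<phi>[OF that]] \<phi>[OF that] NV by auto
    show "\<phi> x \<in> T" if "x \<in> S" for x using \<phi>[OF that] by (force simp: T_def)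
  qed (use farST finN in \<open>auto simp: S_def\<close>)
  then have "routable ?E S T l"
    by (rule consistent_imp_routable[OF finite_augmented_hypergrid completes_squares_augmented_hypergrid
        completes_squares_augmented_hypergrid_converse])
  then obtain p where p: "\<And>x. x \<in> S \<Longrightarrow> p x 0 = x" "\<And>x. x \<in> S \<Longrightarrow> p x l \<in> T"
    "\<And>x. x \<in> S \<Longrightarrow> \<forall>i<l. (p x i, p x (Suc i)) \<in> ?E"
    and inj: "\<And>i. i \<le> l \<Longrightarrow> inj_on (\<lambda>x. p x i) S" unfolding routable_def by blast
  \<comment> \<open>The first \<open>i\<close> steps of one walk followed by the last
    \<open>l - j\<close> steps of the other lead from \<open>S\<close> to \<open>T\<close>, so their
    number is at least \<open>l\<close>. By symmetry, walks meet only at equal times.\<close>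
  have order: "j \<le> i" if "x \<in> S" "x' \<in> S" "i \<le> l" "j \<le> l" "p x i = p x' j" for x x' i j
  proof -
    have "(x, p x i) \<in> ?E ^^ i" using walk_segment[OF p(3), of x 0 i] p(1) that by simp
    moreover have "(p x' j, p x' l) \<in> ?E ^^ (l - j)" using walk_segment[OF p(3), of x' j l] that by simp
    ultimately have "(x, p x' l) \<in> ?E ^^ (i + (l - j))" using that(5) relpow_trans by metis
    then have "l \<le> i + (l - j)" using farST p(2) that(1,2) unfolding far_apart_def by blast
    then show ?thesis using that(4) by simp
  qed
  have disjoint: "x = x'" if h: "x \<in> S" "x' \<in> S" "i \<le> l" "j \<le> l" "p x i = p x' j" for x x' i j
  proof -
    have "i = j" using order[OF h] order[of x' x j i] h by simp
    then show ?thesis using inj_onD[OF inj[OF h(3)]] h by blast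
  qed
  have "\<exists>i<l. f (p x i) = 1 \<and> f (p x (Suc i)) \<noteq> 1" if x: "x \<in> S" for x
  proof (rule violating_step_exists)
    show "f (p x 0) = 1" using p(1)[OF x] \<phi>[OF x] NV by (auto simp: violation_graph_def)
    show "f (p x l) \<noteq> 1" using p(2)[OF x] NV by (auto simp: T_def violation_graph_def)
  qed
  then obtain c where c: "\<And>x. x \<in> S \<Longrightarrow> c x < l \<and> f (p x (c x)) = 1 \<and> f (p x (Suc (c x))) \<noteq> 1" by metis
  define e where "e = (\<lambda>x. (p x (c x), p x (Suc (c x))))"
  \<comment> \<open>Edges stay in the grid, where a value other than 1 is 0.\<close>
  have viol: "e x \<in> violating_edges n d f" if "x \<in> S" for x
  proof -
    have "(p x (c x), p x (Suc (c x))) \<in> ?E" using p(3) c that by blast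
    moreover from this have "p x (Suc (c x)) \<in> hypergrid n d" by (auto simp: augmented_hypergrid_def)
    ultimately show ?thesis using f c[OF that] by (fastforce simp: violating_edges_def e_def)
  qed
  have disj: "disjnt {fst (e x), snd (e x)} {fst (e x'), snd (e x')}"
    if "x \<in> S" "x' \<in> S" "x \<noteq> x'" for x x'
  proof -
    have "c x < l" "c x' < l" using c that by auto
    then show ?thesis
      using disjoint[OF that(1,2), of "c x" "c x'"] disjoint[OF that(1,2), of "Suc (c x)" "c x'"]
        disjoint[OF that(1,2), of "c x" "Suc (c x')"] disjoint[OF that(1,2), of "Suc (c x)" "Suc (c x')"] that(3)
      by (simp add: disjnt_def e_def) metis
  qed
  have "is_matching (violating_edges n d f) (e ` S)"
    unfolding is_matching_def
  proof (intro conjI pairwiseI)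
    fix a b assume "a \<in> e ` S" "b \<in> e ` S" "a \<noteq> b"
    then show "(\<lambda>(x, y) (x', y'). disjnt {x, y} {x', y'}) a b"
      using disj by (auto simp: case_prod_beta)
  qed (use viol in blast)
  moreover have "inj_on e S" using disj by (fastforce simp: inj_on_def disjnt_def)
  moreover have "inj_on fst N" using is_matching_fst_eq[OF N] by (auto simp: inj_on_def)
  ultimately show ?thesis using card_image unfolding S_def by metis
qed

theorem theorem2p3:
  shows "\<exists>c::real. c > 0 \<and>
    (\<forall>(n::nat) (d::nat) (f :: point \<Rightarrow> nat) (\<epsilon>::real).
       n \<ge> 1 \<longrightarrow> d \<ge> 1 \<longrightarrow> \<epsilon> > 0 \<longrightarrow>
       f \<in> hypergrid n d \<rightarrow> {0, 1} \<longrightarrow>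
       far_from_monotone n d \<epsilon> f \<longrightarrow>
       Gamma_minus n d f \<ge> c * \<epsilon> / min_average_dist n d f)"
proof (intro exI[of _ "1/16"] conjI allI impI)
  fix n d :: nat and f :: "point \<Rightarrow> nat" and \<epsilon> :: real
  assume n: "n \<ge> 1" and \<epsilon>: "\<epsilon> > 0" and f: "f \<in> hypergrid n d \<rightarrow> {0, 1}"
    and far: "far_from_monotone n d \<epsilon> f"
  let ?V = "violation_graph n d f"
  define r where "r = min_average_dist n d f"
  define w where "w = (\<lambda>(x, y). augmented_dist n d x y)"
  define G where "G = Max (card ` {M. is_matching (violating_edges n d f) M})"
  have G: "card M \<le> G" if "is_matching (violating_edges n d f) M" for M
    unfolding G_def using that finite_matchings[OF finite_violating_edges] by (intro Max_ge) auto
  have "r \<in> average_dist n d ` {M. is_maximal_matching ?V M}"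
    unfolding r_def min_average_dist_def
    using finite_maximal_matchings[OF finite_violation_graph] maximal_matching_exists[OF finite_violation_graph]
    by (intro Min_in) auto
  then obtain M where M: "is_maximal_matching ?V M" and rM: "r = average_dist n d M" by blast
  have match: "is_matching ?V M" and MV: "M \<subseteq> ?V"
    using M by (auto simp: is_maximal_matching_def is_matching_def)
  have finM: "finite M" using MV finite_violation_graph finite_subset by blast
  have large: "\<epsilon> * real n ^ d \<le> 2 * real (card M)"
    using far_from_monotone_card_maximal_matching[OF f far M] .
  have pos: "real n ^ d > 0" "\<epsilon> * real n ^ d > 0" using n \<epsilon> by auto
  \<comment> \<open>This rules out the default value 0 of the average over an empty
    matching.\<close>
  then have "card M > 0" using large by linarith
  then have total: "(\<Sum>e\<in>M. real (w e)) = r * real (card M)"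
    by (simp add: rM average_dist_def w_def case_prod_unfold)
  have r0: "r \<ge> 0" unfolding rM average_dist_def by (intro divide_nonneg_nonneg sum_nonneg) auto

  \<comment> \<open>Weights are natural numbers, so at most \<open>k\<close> means at most
    \<open>2 * r\<close>.\<close>
  define k where "k = nat \<lfloor>2 * r\<rfloor>"
  define P where "P = {e\<in>M. w e \<le> k}"
  \<comment> \<open>Markov's inequality: at most half of the pairs exceed twice the average.\<close>
  have "2 * r * real (card (M - P)) \<le> (\<Sum>e\<in>M - P. real (w e))"
  proof -
    have "2 * r \<le> real (w e)" if "e \<in> M - P" for e
    proof -
      have "\<lfloor>2 * r\<rfloor> < int (w e)" using that r0 by (auto simp: P_def k_def)
      then show ?thesis by linarith
    qed
    then show ?thesis using sum_bounded_below[of "M - P" "2 * r" "\<lambda>e. real (w e)"]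
      by (simp add: mult.commute)
  qed
  also have "\<dots> \<le> (\<Sum>e\<in>M. real (w e))" using finM by (intro sum_mono2) auto
  finally have "r * (2 * real (card (M - P))) \<le> r * real (card M)" using total by (simp add: mult_ac)
  \<comment> \<open>Violating pairs have distance at least 1, so \<open>r\<close> can be
    cancelled.\<close>
  moreover have "r \<noteq> 0"
  proof
    assume "r = 0"
    then have "w e = 0" if "e \<in> M" for e
      using total finM that sum_nonneg_eq_0_iff[of M "\<lambda>e. real (w e)"] by auto
    moreover have "w e \<ge> 1" if "e \<in> M" for e using augmented_dist_pos[of "fst e" "snd e" n d f] that MV by (auto simp: w_def case_prod_beta)
    ultimately show False using \<open>card M > 0\<close> by (metis card_gt_0_iff ex_in_conv not_one_le_zero)
  qed
  ultimately have "2 * card (M - P) \<le> card M" using r0 by (auto simp: mult_le_cancel_left)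
  moreover have "card M = card (M - P) + card P"
    using finM card_Diff_subset[of P M] card_mono[of M P] by (auto simp: P_def)
  ultimately have MP: "card M \<le> 2 * card P" by linarith

  obtain N where N: "is_maximal_matching {e\<in>?V. w e \<le> k} N"
    and opt: "\<And>x y x' y'. (x, y) \<in> N \<Longrightarrow> (x', y') \<in> N \<Longrightarrow> w (x, y) = w (x', y') \<Longrightarrow> (x, y') \<in> ?V \<Longrightarrow>
       w (x, y) \<le> w (x, y')"
    using greedy_matching[OF finite_violation_graph, where w = w and k = k] by blast
  have matchN: "is_matching {e\<in>?V. w e \<le> k} N" and NV: "N \<subseteq> {e\<in>?V. w e \<le> k}"
    using N by (auto simp: is_maximal_matching_def is_matching_def)
  have finN: "finite N" using NV finite_violation_graph finite_subset by fastforce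
  have "is_matching {e\<in>?V. w e \<le> k} P"
    by (rule is_matching_subset[OF match]) (use MV in \<open>auto simp: P_def\<close>)
  then have PN: "card P \<le> 2 * card N"
    using card_matching_le_twice_maximal[OF _ N] finite_violation_graph by auto

  have "card {e\<in>N. w e = l} \<le> G" for l
  proof -
    have "\<exists>M. is_matching (violating_edges n d f) M \<and> card M = card {e\<in>N. w e = l}"
    proof (rule violating_matching_from_distance_class[OF f])
      show "is_matching ?V {e\<in>N. w e = l}" by (rule is_matching_subset[OF matchN]) (use NV in auto)
      show "l \<le> augmented_dist n d x y'"
        if "(x, y) \<in> {e\<in>N. w e = l}" "(x', y') \<in> {e\<in>N. w e = l}" "(x, y') \<in> ?V" for x y x' y'
        using opt[of x y x' y'] that by (simp add: w_def)
    qed (simp add: w_def)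
    then show ?thesis using G by metis
  qed
  \<comment> \<open>Distances start at 1, so there are \<open>k\<close> classes and not
    \<open>k + 1\<close>.\<close>
  moreover have "card N = (\<Sum>l\<in>{1..k}. card {e\<in>N. w e = l})"
  proof -
    have "w ` N \<subseteq> {1..k}" using NV augmented_dist_pos by (fastforce simp: w_def)
    then show ?thesis
      using sum.group[of N "{1..k}" w "\<lambda>_. 1::nat"] finN by simp
  qed
  ultimately have "card N \<le> k * G"
    using sum_bounded_above[of "{1..k}" "\<lambda>l. card {e\<in>N. w e = l}" G] by simp
  then have "real (card N) \<le> real k * real G" by (metis of_nat_le_iff of_nat_mult)
  also have "\<dots> \<le> 2 * r * real G" using r0 by (intro mult_right_mono) (auto simp: k_def)
  \<comment> \<open>The 16 collects four factors 2: two endpoints per pair of \<open>M\<close>, the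
    passage from \<open>M\<close> to \<open>P\<close>, the passage from \<open>P\<close> to
    \<open>N\<close>, and the \<open>2 * r\<close> distance classes.\<close>
  finally have "\<epsilon> * real n ^ d \<le> 16 * r * real G" using large MP PN by linarith
  then show "1 / 16 * \<epsilon> / min_average_dist n d f \<le> Gamma_minus n d f"
    using pos(1) r0 \<open>r \<noteq> 0\<close> unfolding Gamma_minus_def G_def[symmetric] r_def[symmetric]
    by (simp add: field_simps)
qed simp

end
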